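(* Let $X$ be a set. In $\mathcal{P}_X$, with $\leq$ the Mitsch order and $\subseteq$ inclusion: (i) $\subseteq\circ\leq$ is a preorder on $\mathcal{P}_X$; (ii) $\leq\circ\subseteq$ is contained in $\subseteq\circ\leq$; (iii) $\subseteq\circ\leq$ is the join of $\subseteq$ and $\leq$ in the lattice of preorders on $\mathcal{P}_X$.
   Context: The partition monoid $\mathcal{P}_X$ consists of all set partitions of the disjoint union $X\sqcup X=X_0\cup X_1$ of two copies of $X$. An element $a\in\mathcal{P}_X$ is identified with the graph on $X_0\cup X_1$ in which $\{i,j\}$ is an edge iff $i,j$ lie in the same block of $a$ (a union of cliques). Product: given $a,b\in\mathcal{P}_X$, regard $a$ as a graph on $X_0\cup X_1$ and $b$ as a graph on $X_1\cup X_2$ (with $X_0,X_1,X_2$ pairwise disjoint copies of $X$), and let $\Gamma$ be the union of these graphs on $X_0\cup X_1\cup X_2$; then $ab$ is the partition of $X_0\cup X_2$ (identified with $X\sqcup X$) in which $i,j\in X_0\cup X_2$ are in the same block iff there is a path in $\Gamma$ from $i$ to $j$. Inclusion order: $a\subseteq b$ iff every edge of $a$ is an edge of $b$ (i.e. $a$ refines $b$). The Mitsch order $\leq$ on any semigroup $S$ is: $a\leq b$ iff $a=b$ or there are $x,y\in S$ with $a=ax=bx=yb$; here $S=\mathcal{P}_X$. For relations $\rho,\sigma$ on the set $\mathcal{P}_X$, $a\,(\rho\circ\sigma)\,b$ iff there is $c\in\mathcal{P}_X$ with $a\,\rho\,c$ and $c\,\sigma\,b$. A preorder is a reflexive transitive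 relation; preorders on $\mathcal{P}_X$, ordered by containment, form a lattice, in which the join of two preorders is the least preorder containing both. *)

theory Defs
  imports "HOL-Algebra.Group" "HOL-Library.Disjoint_Sets"
begin

(* The disjoint union of two copies of X is X <+> X, with X_0 = Inl ` X and the second copy
   Inr ` X. A partition is a set of blocks; X may be empty or infinite. *)

(* The graph of a partition, as a symmetric relation. It contains the loops (i, i), which affect
   neither the existence of paths nor the comparison of two partitions of the same set. *)
definition edges :: "'b set set \<Rightarrow> 'b rel" where
  "edges a = {(i, j). \<exists>B\<in>a. i \<in> B \<and> j \<in> B}"

(* Places the two copies of X at levels k and l; level k is the copy X_k of X in the three-level
   set of vertices used for the product. *)
definition at_levels :: "nat \<Rightarrow> nat \<Rightarrow> 'a + 'a \<Rightarrow> nat \<times> 'a" where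
  "at_levels k l = case_sum (Pair k) (Pair l)"

definition product_graph :: "('a + 'a) set set \<Rightarrow> ('a + 'a) set set \<Rightarrow> (nat \<times> 'a) rel" where
  "product_graph a b =
     map_prod (at_levels 0 1) (at_levels 0 1) ` edges a \<union>
     map_prod (at_levels 1 2) (at_levels 1 2) ` edges b"

definition partition_mult ::
  "'a set \<Rightarrow> ('a + 'a) set set \<Rightarrow> ('a + 'a) set set \<Rightarrow> ('a + 'a) set set" where
  "partition_mult X a b =
     (X <+> X) // {(i, j) \<in> (X <+> X) \<times> (X <+> X).
                     (at_levels 0 2 i, at_levels 0 2 j) \<in> (product_graph a b)\<^sup>*}"

definition partition_monoid :: "'a set \<Rightarrow> ('a + 'a) set set monoid" where
  "partition_monoid X =
     \<lparr>carrier = {a. partition_on (X <+> X) a},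
      mult = partition_mult X,
      one = (\<lambda>x. {Inl x, Inr x}) ` X\<rparr>"

definition inclusion_order :: "'a set \<Rightarrow> ('a + 'a) set set rel" where
  "inclusion_order X =
     {(a, b) \<in> carrier (partition_monoid X) \<times> carrier (partition_monoid X). edges a \<subseteq> edges b}"

(* Only the carrier and the multiplication of G are used, so this is the Mitsch order of the
   underlying semigroup. *)
definition mitsch_order :: "('a, 'm) monoid_scheme \<Rightarrow> 'a rel" where
  "mitsch_order G =
     {(a, b) \<in> carrier G \<times> carrier G.
        a = b \<or> (\<exists>x\<in>carrier G. \<exists>y\<in>carrier G.
          a = a \<otimes>\<^bsub>G\<^esub> x \<and> a = b \<otimes>\<^bsub>G\<^esub> x \<and> a = y \<otimes>\<^bsub>G\<^esub> b)}"

(* t is the join of r and s in the lattice of preorders on A; in particular r and s are themselves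
   elements of that lattice. *)
definition is_preorder_join :: "'b set \<Rightarrow> 'b rel \<Rightarrow> 'b rel \<Rightarrow> 'b rel \<Rightarrow> bool" where
  "is_preorder_join A r s t \<longleftrightarrow>
     preorder_on A r \<and> preorder_on A s \<and> preorder_on A t \<and> r \<subseteq> t \<and> s \<subseteq> t \<and>
     (\<forall>u. preorder_on A u \<longrightarrow> r \<subseteq> u \<longrightarrow> s \<subseteq> u \<longrightarrow> t \<subseteq> u)"

end

theory Submission
  imports Defs
begin

text \<open>
  For a partition \<open>c\<close> let \<open>T c\<close> be the partition obtained from \<open>c\<close> by merging all transversal
  blocks (those meeting both copies of \<open>X\<close>) into one. Everything rests on three facts:
  \<open>a \<le> b\<close> in the Mitsch order implies \<open>a \<subseteq> T b\<close>; \<open>T c \<le> c\<close>; and \<open>T\<close> is monotone and idempotent.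
  They give that \<open>a (\<subseteq> \<circ> \<le>) c\<close> holds iff \<open>a \<subseteq> T c\<close>, which is visibly transitive and contains
  both orders.
\<close>

section \<open>Partitions as equivalence relations\<close>

lemma equiv_edges: "partition_on A a \<Longrightarrow> equiv A (edges a)"
  unfolding edges_def by (rule equiv_partition_on)

lemma quotient_edges: "partition_on A a \<Longrightarrow> A // edges a = a"
  unfolding edges_def by (rule partition_on_eq_quotient)

text \<open>Together with \<open>quotient_edges\<close>, this makes passing between partitions and
  equivalences a bijection, so products can be compared through their edge relations.\<close>

lemma edges_quotient:
  assumes "equiv A r"
  shows "edges (A // r) = r"
proof (intro subset_antisym subrelI)
  fix i j assume "(i, j) \<in> edges (A // r)"
  then obtain x where "(x, i) \<in> r" "(x, j) \<in> r"
    by (auto simp: edges_def quotient_def)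
  then show "(i, j) \<in> r"
    using assms by (meson equiv_def symD transD)
next
  fix i j assume ij: "(i, j) \<in> r"
  then have "i \<in> A" "i \<in> r `` {i}"
    using assms by (auto simp: equiv_def refl_on_def)
  then show "(i, j) \<in> edges (A // r)"
    using ij unfolding edges_def quotient_def by blast
qed

lemma partition_eqI:
  assumes "partition_on A a" "partition_on A b" "edges a = edges b"
  shows "a = b"
  using assms by (metis quotient_edges)

lemma rtrancl_image:
  assumes "\<And>u v. (u, v) \<in> r \<Longrightarrow> (f u, f v) \<in> s" and "(u, v) \<in> r\<^sup>*"
  shows "(f u, f v) \<in> s\<^sup>*"
  using assms(2)
  by (induction rule: rtrancl_induct) (auto intro: assms(1) rtrancl_into_rtrancl)

section \<open>Graphs on levels and the edges of a product\<close>

lemma at_levels_simps [simp]: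
  "at_levels k l (Inl x) = (k, x)" "at_levels k l (Inr x) = (l, x)"
  by (auto simp: at_levels_def)

lemma apfst_at_levels: "apfst f (at_levels k l i) = at_levels (f k) (f l) i"
  by (cases i) auto

text \<open>The levels are free, unlike in \<open>product_graph\<close>, so that three factors can
  be drawn on levels 0 to 3.\<close>

definition level_graph :: "nat \<Rightarrow> nat \<Rightarrow> ('a + 'a) set set \<Rightarrow> (nat \<times> 'a) rel" where
  "level_graph k l a = map_prod (at_levels k l) (at_levels k l) ` edges a"

lemma product_graph_eq: "product_graph a b = level_graph 0 1 a \<union> level_graph 1 2 b"
  by (simp add: product_graph_def level_graph_def)

lemma in_level_graph:
  "(u, v) \<in> level_graph k l a \<longleftrightarrow>
     (\<exists>i j. (i, j) \<in> edges a \<and> u = at_levels k l i \<and> v = at_levels k l j)"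
  by (auto simp: level_graph_def)

lemma level_graphI: "(i, j) \<in> edges a \<Longrightarrow> (at_levels k l i, at_levels k l j) \<in> level_graph k l a"
  by (auto simp: in_level_graph)

lemma level_of_level_graph:
  fixes a :: "('a + 'a) set set"
  shows
  "(u, v) \<in> level_graph k l a \<Longrightarrow> fst u \<in> {k, l} \<and> fst v \<in> {k, l}"
proof -
  have "fst (at_levels k l i) \<in> {k, l}" for i :: "'a + 'a"
    by (cases i) auto
  then show "(u, v) \<in> level_graph k l a \<Longrightarrow> fst u \<in> {k, l} \<and> fst v \<in> {k, l}"
    unfolding in_level_graph by blast
qed

lemma sym_edges: "sym (edges a)"
  by (auto simp: sym_def edges_def)

lemma sym_level_graph: "sym (level_graph k l a)"
  using sym_edges[of a] unfolding sym_def in_level_graph by blast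

definition mult_edges :: "'a set \<Rightarrow> ('a + 'a) set set \<Rightarrow> ('a + 'a) set set \<Rightarrow> ('a + 'a) rel" where
  "mult_edges X a b = {(i, j) \<in> (X <+> X) \<times> (X <+> X).
     (at_levels 0 2 i, at_levels 0 2 j) \<in> (product_graph a b)\<^sup>*}"

lemma equiv_mult_edges: "equiv (X <+> X) (mult_edges X a b)"
proof -
  have "sym ((product_graph a b)\<^sup>*)"
    unfolding product_graph_eq by (intro sym_rtrancl sym_Un sym_level_graph)
  then show ?thesis
    by (auto simp: equiv_def refl_on_def sym_def trans_def mult_edges_def)
qed

lemma partition_on_mult: "partition_on (X <+> X) (partition_mult X a b)"
  unfolding partition_mult_def
  using partition_on_quotient[OF equiv_mult_edges, of X a b, unfolded mult_edges_def] .

lemma edges_mult: "edges (partition_mult X a b) = mult_edges X a b"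
  using edges_quotient[OF equiv_mult_edges, of X a b]
  by (simp add: partition_mult_def mult_edges_def)

subsection \<open>Associativity\<close>

lemma relabel_levels:
  fixes a b :: "('a + 'a) set set"
  assumes "(u, v) \<in> (level_graph k l a \<union> level_graph l m b)\<^sup>*"
  shows "(apfst f u, apfst f v) \<in> (level_graph (f k) (f l) a \<union> level_graph (f l) (f m) b)\<^sup>*"
proof -
  have "(apfst f u, apfst f v) \<in> level_graph (f p) (f q) c" if "(u, v) \<in> level_graph p q c"
    for u v p q and c :: "('a + 'a) set set"
    using that unfolding in_level_graph by (metis apfst_at_levels)
  then show ?thesis
    by (intro rtrancl_image[OF _ assms]) blast
qed

text \<open>Renaming the levels 0, 1, 2 to distinct \<open>k\<close>, \<open>l\<close>,
  \<open>m\<close> can be undone, and renaming carries paths to paths in both directions.\<close>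

lemma mult_edges_at_levels:
  assumes "k \<noteq> l" "l \<noteq> m" "k \<noteq> m"
  shows "(i, j) \<in> mult_edges X a b \<longleftrightarrow> i \<in> X <+> X \<and> j \<in> X <+> X \<and>
    (at_levels k m i, at_levels k m j) \<in> (level_graph k l a \<union> level_graph l m b)\<^sup>*"
proof -
  \<comment> \<open>\<open>f\<close> and \<open>g\<close> are inverse to each other on the levels
    that occur; \<open>id\<close> only fills in the remaining values.\<close>
  define f where "f = id(0 := k, 1 := l, 2 := m)"
  define g where "g = id(k := 0, l := 1, m := 2)"
  have f: "f 0 = k" "f 1 = l" "f 2 = m"
    by (auto simp: f_def)
  have g: "g k = 0" "g l = 1" "g m = 2"
    using assms by (auto simp: g_def)
  have "(at_levels 0 2 i, at_levels 0 2 j) \<in> (level_graph 0 1 a \<union> level_graph 1 2 b)\<^sup>* \<longleftrightarrow>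
    (at_levels k m i, at_levels k m j) \<in> (level_graph k l a \<union> level_graph l m b)\<^sup>*"
    using relabel_levels[of "at_levels 0 2 i" "at_levels 0 2 j" 0 1 a 2 b f]
      relabel_levels[of "at_levels k m i" "at_levels k m j" k l a m b g]
    unfolding apfst_at_levels f g by blast
  then show ?thesis
    by (auto simp: mult_edges_def product_graph_eq)
qed

text \<open>The \<open>Q\<close>-edges cut a path into \<open>P\<close>-segments whose ends all lie
  in \<open>N\<close>, and each segment can be replaced by an \<open>R\<close>-path.\<close>

lemma rtrancl_shortcut:
  assumes R: "\<And>u v. u \<in> N \<Longrightarrow> v \<in> N \<Longrightarrow> (u, v) \<in> P\<^sup>* \<Longrightarrow> (u, v) \<in> R\<^sup>*"
    and Q: "Q \<subseteq> N \<times> N" and uv: "u \<in> N" "v \<in> N"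
    and path: "(u, v) \<in> (P \<union> Q)\<^sup>*"
  shows "(u, v) \<in> (R \<union> Q)\<^sup>*"
proof -
  have jump: "(w, x) \<in> (R \<union> Q)\<^sup>*" if "w \<in> N" "x \<in> N" "(w, x) \<in> P\<^sup>*" for w x
    using R[OF that] rtrancl_mono[of R "R \<union> Q"] by auto
  \<comment> \<open>The invariant keeps the start \<open>w\<close> of the current
    \<open>P\<close>-segment, which is replaced only when a \<open>Q\<close>-edge or the end of the
    path closes it.\<close>
  from path have "\<exists>w\<in>N. (u, w) \<in> (R \<union> Q)\<^sup>* \<and> (w, v) \<in> P\<^sup>*"
  proof (induction rule: rtrancl_induct)
    case base
    then show ?case using uv by auto
  next
    case (step x y)
    then obtain w where w: "w \<in> N" "(u, w) \<in> (R \<union> Q)\<^sup>*" "(w, x) \<in> P\<^sup>*" by auto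
    show ?case
    proof (cases "(x, y) \<in> P")
      case True
      then show ?thesis using w by (meson rtrancl.rtrancl_into_rtrancl)
    next
      case False
      then have xy: "(x, y) \<in> Q" using step by auto
      then have "x \<in> N" "y \<in> N" using Q by auto
      then have "(u, x) \<in> (R \<union> Q)\<^sup>*"
        using w jump by (meson rtrancl_trans)
      then have "(u, y) \<in> (R \<union> Q)\<^sup>*" using xy by (meson UnI2 rtrancl.rtrancl_into_rtrancl)
      then show ?thesis using \<open>y \<in> N\<close> by auto
    qed
  qed
  then show ?thesis using jump uv by (meson rtrancl_trans)
qed

text \<open>Here \<open>Q\<close> is the rest of a larger diagram. As it avoids the middle level
  \<open>l\<close>, two factors may be replaced by their product inside that diagram.\<close>

lemma contract_level:
  assumes a: "partition_on (X <+> X) a" and b: "partition_on (X <+> X) b"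
    and lev: "k \<noteq> l" "l \<noteq> m" "k \<noteq> m"
    and Q: "\<And>u v. (u, v) \<in> Q \<Longrightarrow> fst u \<noteq> l \<and> fst v \<noteq> l"
    and uv: "fst u \<noteq> l" "fst v \<noteq> l"
  shows "(u, v) \<in> (level_graph k m (partition_mult X a b) \<union> Q)\<^sup>* \<longleftrightarrow>
    (u, v) \<in> (level_graph k l a \<union> level_graph l m b \<union> Q)\<^sup>*"
proof
  let ?P = "level_graph k l a \<union> level_graph l m b"
  let ?R = "level_graph k m (partition_mult X a b)"
  assume "(u, v) \<in> (?R \<union> Q)\<^sup>*"
  moreover have "?R \<subseteq> ?P\<^sup>*"
    using mult_edges_at_levels[OF lev, of _ _ X a b] by (auto simp: in_level_graph edges_mult)
  then have "?R \<union> Q \<subseteq> (?P \<union> Q)\<^sup>*"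
    using rtrancl_mono[of ?P "?P \<union> Q"] by auto
  ultimately show "(u, v) \<in> (?P \<union> Q)\<^sup>*"
    by (metis rtrancl_idemp rtrancl_mono subsetD)
next
  let ?P = "level_graph k l a \<union> level_graph l m b"
  let ?R = "level_graph k m (partition_mult X a b)"
  \<comment> \<open>\<open>mult_edges\<close> relates only points of \<open>X <+> X\<close>, while
    \<open>u\<close> and \<open>v\<close> may be any vertices off level \<open>l\<close>. An end of
    a nonempty path meets an edge of \<open>a\<close> or \<open>b\<close>, hence comes from
    \<open>X <+> X\<close>.\<close>
  have ext: "\<exists>i\<in>X <+> X. w = at_levels k m i" if "(w, x) \<in> ?P \<or> (x, w) \<in> ?P" "fst w \<noteq> l" for w x
  proof -
    have V: "edges a \<subseteq> (X <+> X) \<times> (X <+> X)" "edges b \<subseteq> (X <+> X) \<times> (X <+> X)"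
      using a b by (auto dest!: equiv_edges equiv_type)
    have "snd w \<in> X" "fst w = k \<or> fst w = m"
      using that V level_of_level_graph[of w x] level_of_level_graph[of x w]
      by (fastforce simp: in_level_graph)+
    then show ?thesis
      by (metis InlI InrI at_levels_simps prod.collapse)
  qed
  have "(w, x) \<in> ?R\<^sup>*" if "fst w \<noteq> l" "fst x \<noteq> l" and wx: "(w, x) \<in> ?P\<^sup>*" for w x
  proof (cases "w = x")
    case False
    with wx obtain w' x' where "(w, w') \<in> ?P" "(x', x) \<in> ?P"
      by (metis converse_rtranclE rtranclE)
    with ext that obtain i j where
      "i \<in> X <+> X" "j \<in> X <+> X" "w = at_levels k m i" "x = at_levels k m j"
      by metis
    with wx have "(w, x) \<in> ?R"
      using mult_edges_at_levels[OF lev, of i j X a b] by (auto simp: edges_mult intro: level_graphI)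
    then show ?thesis by auto
  qed auto
  then have shortcut: "(w, x) \<in> ?R\<^sup>*"
    if "w \<in> fst -` (- {l})" "x \<in> fst -` (- {l})" "(w, x) \<in> ?P\<^sup>*" for w x
    using that by simp
  have Q': "Q \<subseteq> fst -` (- {l}) \<times> fst -` (- {l})"
    using Q by auto
  have uv': "u \<in> fst -` (- {l})" "v \<in> fst -` (- {l})"
    using uv by simp_all
  assume "(u, v) \<in> (?P \<union> Q)\<^sup>*"
  from rtrancl_shortcut[OF shortcut Q' uv' this] show "(u, v) \<in> (?R \<union> Q)\<^sup>*" .
qed

text \<open>Both bracketings describe connectivity between levels 0 and 3 when the three factors are
  stacked: one contracts level 1, the other level 2.\<close>

lemma partition_mult_assoc:
  assumes a: "partition_on (X <+> X) a" and b: "partition_on (X <+> X) b"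
    and c: "partition_on (X <+> X) c"
  shows "partition_mult X (partition_mult X a b) c = partition_mult X a (partition_mult X b c)"
proof (rule partition_eqI[OF partition_on_mult partition_on_mult])
  have lev: "fst (at_levels 0 3 t) \<noteq> 1" "fst (at_levels 0 3 t) \<noteq> 2" for t :: "'a + 'a"
    by (cases t; simp)+
  have "(i, j) \<in> mult_edges X (partition_mult X a b) c \<longleftrightarrow>
    (i, j) \<in> mult_edges X a (partition_mult X b c)" for i j
  proof -
    have "(at_levels 0 3 i, at_levels 0 3 j)
        \<in> (level_graph 0 2 (partition_mult X a b) \<union> level_graph 2 3 c)\<^sup>* \<longleftrightarrow>
      (at_levels 0 3 i, at_levels 0 3 j)
        \<in> (level_graph 0 1 a \<union> level_graph 1 2 b \<union> level_graph 2 3 c)\<^sup>*"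
      by (rule contract_level[OF a b]) (use lev in \<open>auto dest: level_of_level_graph\<close>)
    moreover have "(at_levels 0 3 i, at_levels 0 3 j)
        \<in> (level_graph 1 3 (partition_mult X b c) \<union> level_graph 0 1 a)\<^sup>* \<longleftrightarrow>
      (at_levels 0 3 i, at_levels 0 3 j)
        \<in> (level_graph 1 2 b \<union> level_graph 2 3 c \<union> level_graph 0 1 a)\<^sup>*"
      by (rule contract_level[OF b c]) (use lev in \<open>auto dest: level_of_level_graph\<close>)
    ultimately show ?thesis
      using mult_edges_at_levels[of 0 2 3 i j X "partition_mult X a b" c]
        mult_edges_at_levels[of 0 1 3 i j X a "partition_mult X b c"]
      by (simp add: Un_ac)
  qed
  then show "edges (partition_mult X (partition_mult X a b) c) =
      edges (partition_mult X a (partition_mult X b c))"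
    by (auto simp: edges_mult)
qed

section \<open>The two orders as preorders\<close>

lemma partition_monoid_simps [simp]:
  "carrier (partition_monoid X) = {a. partition_on (X <+> X) a}"
  "a \<otimes>\<^bsub>partition_monoid X\<^esub> b = partition_mult X a b"
  by (simp_all add: partition_monoid_def)

lemma semigroup_partition_monoid:
  fixes X :: "'a set"
  defines "G \<equiv> partition_monoid X"
  shows "\<And>a b. a \<in> carrier G \<Longrightarrow> b \<in> carrier G \<Longrightarrow> a \<otimes>\<^bsub>G\<^esub> b \<in> carrier G"
    and "\<And>a b c. a \<in> carrier G \<Longrightarrow> b \<in> carrier G \<Longrightarrow> c \<in> carrier G \<Longrightarrow>
      a \<otimes>\<^bsub>G\<^esub> b \<otimes>\<^bsub>G\<^esub> c = a \<otimes>\<^bsub>G\<^esub> (b \<otimes>\<^bsub>G\<^esub> c)"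
  by (auto simp: G_def partition_on_mult partition_mult_assoc)

lemma trans_mitsch_order:
  fixes G (structure)
  assumes closed: "\<And>a b. a \<in> carrier G \<Longrightarrow> b \<in> carrier G \<Longrightarrow> a \<otimes> b \<in> carrier G"
    and assoc: "\<And>a b c. a \<in> carrier G \<Longrightarrow> b \<in> carrier G \<Longrightarrow> c \<in> carrier G \<Longrightarrow>
      a \<otimes> b \<otimes> c = a \<otimes> (b \<otimes> c)"
  shows "trans (mitsch_order G)"
proof (rule transI)
  fix a b c assume ab: "(a, b) \<in> mitsch_order G" and bc: "(b, c) \<in> mitsch_order G"
  show "(a, c) \<in> mitsch_order G"
  proof (cases "a = b \<or> b = c")
    case False
    with ab bc obtain x y z w where G: "a \<in> carrier G" "b \<in> carrier G" "c \<in> carrier G"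
        "x \<in> carrier G" "y \<in> carrier G" "z \<in> carrier G" "w \<in> carrier G"
      and a: "a = a \<otimes> x" "a = b \<otimes> x" "a = y \<otimes> b"
      and b: "b = b \<otimes> z" "b = c \<otimes> z" "b = w \<otimes> c"
      unfolding mitsch_order_def by blast
    have "a = c \<otimes> (z \<otimes> x)"
      using G a(2) b(2) assoc by metis
    moreover have "a = y \<otimes> w \<otimes> c"
      using G a(3) b(3) assoc by metis
    \<comment> \<open>\<open>a\<close> is a left multiple of \<open>b\<close>, and \<open>z\<close>
      fixes \<open>b\<close> on the right, so \<open>z\<close> fixes \<open>a\<close> too.\<close>
    moreover have "a \<otimes> z = a"
      using G a(3) b(1) assoc by metis
    then have "a = a \<otimes> (z \<otimes> x)"
      using G a(1) assoc by metis
    ultimately show ?thesis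
      using G closed unfolding mitsch_order_def by blast
  qed (use ab bc in auto)
qed

lemma preorder_mitsch_partition_monoid:
  "preorder_on (carrier (partition_monoid X)) (mitsch_order (partition_monoid X))"
proof -
  have "trans (mitsch_order (partition_monoid X))"
    by (rule trans_mitsch_order) (fact semigroup_partition_monoid)+
  then show ?thesis
    by (auto simp: preorder_on_def refl_on_def mitsch_order_def)
qed

lemma preorder_inclusion_order: "preorder_on (carrier (partition_monoid X)) (inclusion_order X)"
  by (auto simp: preorder_on_def refl_on_def inclusion_order_def trans_def)

subsection \<open>Merging the transversal blocks\<close>

definition transversal_part :: "('a + 'a) set set \<Rightarrow> ('a + 'a) set" where
  "transversal_part c = {i. \<exists>x y. (i, Inl x) \<in> edges c \<and> (i, Inr y) \<in> edges c}"

text \<open>The edge relation of T c from the overview; T c itself is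
  \<open>merge_transversals X c\<close>.\<close>

definition merged_edges :: "('a + 'a) set set \<Rightarrow> ('a + 'a) rel" where
  "merged_edges c = edges c \<union> transversal_part c \<times> transversal_part c"

definition merge_transversals :: "'a set \<Rightarrow> ('a + 'a) set set \<Rightarrow> ('a + 'a) set set" where
  "merge_transversals X c = (X <+> X) // merged_edges c"

lemma transversal_part_edges:
  assumes "partition_on A c" "i \<in> transversal_part c" "(i, j) \<in> edges c"
  shows "j \<in> transversal_part c"
proof -
  have "(j, t) \<in> edges c" if "(i, t) \<in> edges c" for t
    using equiv_edges[OF assms(1)] assms(3) that by (meson equiv_def symD transD)
  with assms(2) show ?thesis
    unfolding transversal_part_def by blast
qed

text \<open>The transversal part is a union of blocks, so joining all its points keeps the relation
  transitive.\<close>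

lemma equiv_merged_edges:
  assumes c: "partition_on A c"
  shows "equiv A (merged_edges c)"
proof -
  note E = equiv_edges[OF c]
  have "merged_edges c \<subseteq> A \<times> A" "refl_on A (merged_edges c)"
    using E by (auto simp: equiv_def refl_on_def merged_edges_def transversal_part_def)
  moreover have "sym (merged_edges c)"
    using E by (auto simp: equiv_def sym_def merged_edges_def)
  moreover have "trans (merged_edges c)"
  proof (rule transI)
    fix i j k assume "(i, j) \<in> merged_edges c" "(j, k) \<in> merged_edges c"
    moreover have "i \<in> transversal_part c" if "(i, j) \<in> edges c" "j \<in> transversal_part c"
      using that transversal_part_edges[OF c] sym_edges by (meson symD)
    moreover have "k \<in> transversal_part c" if "(j, k) \<in> edges c" "j \<in> transversal_part c"
      using that transversal_part_edges[OF c] by blast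
    moreover have "(i, k) \<in> edges c" if "(i, j) \<in> edges c" "(j, k) \<in> edges c"
      using that E by (meson equiv_def transD)
    ultimately show "(i, k) \<in> merged_edges c"
      unfolding merged_edges_def by blast
  qed
  ultimately show ?thesis by (simp add: equiv_def)
qed

lemma edges_merge_transversals:
  "partition_on (X <+> X) c \<Longrightarrow> edges (merge_transversals X c) = merged_edges c"
  unfolding merge_transversals_def by (intro edges_quotient equiv_merged_edges)

text \<open>A class of T c that meets both copies of \<open>X\<close> is the merged one, so
  transversal blocks of \<open>b\<close> fall into it. Assuming b inside T c, rather than inside c,
  covers monotonicity and idempotence of T at once.\<close>

lemma merged_edges_mono:
  assumes c: "partition_on A c" and bc: "edges b \<subseteq> merged_edges c"
  shows "merged_edges b \<subseteq> merged_edges c"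
proof -
  have "i \<in> transversal_part c" if i: "(i, Inl x) \<in> edges b" "(i, Inr y) \<in> edges b" for i x y
  proof -
    have m: "(i, Inl x) \<in> merged_edges c" "(i, Inr y) \<in> merged_edges c"
      using bc i by auto
    then show ?thesis
      by (auto simp: merged_edges_def) (auto simp: transversal_part_def)
  qed
  then show ?thesis
    using bc by (auto simp: merged_edges_def transversal_part_def)
qed

section \<open>Elements below a given one in the Mitsch order\<close>

text \<open>A path that starts on an outer level can only leave it through a transversal block.\<close>
lemma path_from_outer_level:
  assumes a: "partition_on (X <+> X) a" and i: "i \<in> X <+> X" and kl: "k \<noteq> l"
    and Q: "\<And>u v. (u, v) \<in> Q \<Longrightarrow> fst u \<noteq> fst (at_levels k l i)"
    and path: "(at_levels k l i, v) \<in> (level_graph k l a \<union> Q)\<^sup>*"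
    and nt: "i \<notin> transversal_part a"
  shows "\<exists>j. v = at_levels k l j \<and> isl j = isl i \<and> (i, j) \<in> edges a"
  using path
proof (induction rule: rtrancl_induct)
  case base
  then show ?case using i equiv_edges[OF a] by (auto simp: equiv_def refl_on_def)
next
  note E = equiv_edges[OF a]
  case (step v w)
  then obtain j where j: "v = at_levels k l j" "isl j = isl i" "(i, j) \<in> edges a" by auto
  then have "fst v = fst (at_levels k l i)"
    by (cases i; cases j; simp)
  then have "(v, w) \<in> level_graph k l a" using step.hyps(2) Q by blast
  then obtain j' t where jt: "(j', t) \<in> edges a" "v = at_levels k l j'" "w = at_levels k l t"
    by (auto simp: in_level_graph)
  then have "j' = j" using j kl by (cases j; cases j'; auto)
  then have it: "(i, t) \<in> edges a" using jt j E by (meson equiv_def transD)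
  \<comment> \<open>The block of \<open>i\<close> contains \<open>i\<close> itself, so a
    \<open>t\<close> in the other copy would make it transversal.\<close>
  have "(i, i) \<in> edges a" using E i by (auto simp: equiv_def refl_on_def)
  then have "isl t = isl i"
    using it nt by (cases i; cases t; auto simp: transversal_part_def)
  then show ?case using it jt by auto
qed

text \<open>A new edge must leave a block of \<open>b\<close> through the middle level. Writing
  \<open>a\<close> as b x treats ends in the first copy and writing it as y b treats ends in the
  second, so both ends are transversal in \<open>b\<close>.\<close>

lemma mitsch_order_merged_edges:
  assumes ab: "(a, b) \<in> mitsch_order (partition_monoid X)"
  shows "edges a \<subseteq> merged_edges b"
proof (cases "a = b")
  case True
  then show ?thesis by (auto simp: merged_edges_def)
next
  case False
  from ab have a: "partition_on (X <+> X) a" and b: "partition_on (X <+> X) b"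
    by (auto simp: mitsch_order_def)
  from ab False obtain x y where x: "a = partition_mult X b x" and y: "a = partition_mult X y b"
    by (auto simp: mitsch_order_def)
  note E = equiv_edges[OF a]
  have *: "i \<in> transversal_part b \<or> (i, j) \<in> edges b" if ij: "(i, j) \<in> edges a" for i j
  proof (rule disjCI)
    assume "(i, j) \<notin> edges b"
    have V: "i \<in> X <+> X" "j \<in> X <+> X" using E ij by (auto simp: equiv_def)
    show "i \<in> transversal_part b"
    proof (rule ccontr)
      assume nt: "i \<notin> transversal_part b"
      show False
      proof (cases i)
        case (Inl p)
        \<comment> \<open>On the first copy, \<open>at_levels 0 1\<close> and
          \<open>at_levels 0 2\<close> agree: the path starts at level 0, which only
          \<open>b\<close> touches.\<close>
        have path: "(at_levels 0 1 i, at_levels 0 2 j)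
            \<in> (level_graph 0 1 b \<union> level_graph 1 2 x)\<^sup>*"
          using ij edges_mult[of X b x] x Inl by (auto simp: mult_edges_def product_graph_eq)
        have Q: "fst u \<noteq> fst (at_levels 0 1 i)" if "(u, v) \<in> level_graph 1 2 x" for u v
          using level_of_level_graph[OF that] Inl by auto
        have "\<exists>t. at_levels 0 2 j = at_levels 0 1 t \<and> isl t = isl i \<and> (i, t) \<in> edges b"
          by (rule path_from_outer_level[OF b V(1) _ _ path nt]) (simp, erule Q)
        then obtain t where "at_levels 0 2 j = at_levels 0 1 t" "isl t = isl i" "(i, t) \<in> edges b"
          by blast
        then show False
          using \<open>(i, j) \<notin> edges b\<close> Inl by (cases j; cases t) simp_all
      next
        case (Inr p)
        have path: "(at_levels 1 2 i, at_levels 0 2 j)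
            \<in> (level_graph 1 2 b \<union> level_graph 0 1 y)\<^sup>*"
          using ij edges_mult[of X y b] y Inr by (auto simp: mult_edges_def product_graph_eq Un_ac)
        have Q: "fst u \<noteq> fst (at_levels 1 2 i)" if "(u, v) \<in> level_graph 0 1 y" for u v
          using level_of_level_graph[OF that] Inr by auto
        have "\<exists>t. at_levels 0 2 j = at_levels 1 2 t \<and> isl t = isl i \<and> (i, t) \<in> edges b"
          by (rule path_from_outer_level[OF b V(1) _ _ path nt]) (simp, erule Q)
        then obtain t where "at_levels 0 2 j = at_levels 1 2 t" "isl t = isl i" "(i, t) \<in> edges b"
          by blast
        then show False
          using \<open>(i, j) \<notin> edges b\<close> Inr by (cases j; cases t) simp_all
      qed
    qed
  qed
  show ?thesis
  proof (rule subrelI)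
    fix i j assume ij: "(i, j) \<in> edges a"
    then show "(i, j) \<in> merged_edges b"
      \<comment> \<open>Using the edge in both directions puts both of its ends into the transversal
        part.\<close>
      using *[of i j] *[of j i] sym_edges[of a] sym_edges[of b]
      by (auto simp: merged_edges_def sym_def)
  qed
qed

section \<open>Realising the merging of transversal blocks by multiplication\<close>

text \<open>\<open>case_sum id id\<close> forgets the copy in which a point lies.\<close>

definition fuse_edges :: "'a set \<Rightarrow> 'a set \<Rightarrow> ('a + 'a) rel" where
  "fuse_edges X L = {(i, j) \<in> (X <+> X) \<times> (X <+> X).
     case_sum id id i = case_sum id id j \<or> case_sum id id i \<in> L \<and> case_sum id id j \<in> L}"

text \<open>The identity partition with the lines over \<open>L\<close> merged into one block.\<close>
definition fuse :: "'a set \<Rightarrow> 'a set \<Rightarrow> ('a + 'a) set set" where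
  "fuse X L = (X <+> X) // fuse_edges X L"

lemma equiv_fuse_edges: "equiv (X <+> X) (fuse_edges X L)"
  by (auto simp: equiv_def refl_on_def sym_def trans_def fuse_edges_def)

lemma partition_on_fuse: "partition_on (X <+> X) (fuse X L)"
  unfolding fuse_def by (rule partition_on_quotient[OF equiv_fuse_edges])

lemma edges_fuse: "edges (fuse X L) = fuse_edges X L"
  unfolding fuse_def by (rule edges_quotient[OF equiv_fuse_edges])

lemma equiv_rtrancl:
  assumes "equiv A r" "(x, y) \<in> r\<^sup>*" "x \<in> A"
  shows "(x, y) \<in> r"
  using assms(2)
  by (induction rule: rtrancl_induct) (use assms in \<open>auto simp: equiv_def refl_on_def dest: transD\<close>)

text \<open>
  Multiplication on either side by \<open>fuse X L\<close>, where \<open>L\<close> is the trace of the transversal blocks on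
  the side \<open>e\<close> (\<open>Inl\<close> or \<open>Inr\<close>) that is glued to \<open>fuse X L\<close>. The map \<open>\<phi>\<close> collapses the middle
  level onto the outer level of \<open>fuse X L\<close>.
\<close>
lemma fuse_connectivity:
  fixes k l p q :: nat and \<phi> :: "nat \<times> 'a \<Rightarrow> 'a + 'a" and e d d' :: "'a \<Rightarrow> 'a + 'a"
  assumes c: "partition_on (X <+> X) c"
    and cb: "edges c \<subseteq> edges b" and bc: "edges b \<subseteq> merged_edges c"
  defines "L \<equiv> {y. e y \<in> transversal_part c}"
  defines "G \<equiv> level_graph k l b \<union> level_graph p q (fuse X L)"
  assumes e: "e = Inl \<or> e = Inr"
    and \<phi>: "\<And>i. \<phi> (at_levels k l i) = i" "\<And>i. \<phi> (at_levels 0 2 i) = i"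
      "\<And>i. \<phi> (at_levels p q i) = e (case_sum id id i)"
    and d: "\<And>x. case_sum id id (d x) = x" "\<And>x. case_sum id id (d' x) = x"
    and glue: "\<And>x. at_levels k l (e x) = at_levels p q (d x)"
    and outer: "\<And>i. at_levels 0 2 i = at_levels k l i \<or>
      (\<exists>x. i = e x \<and> at_levels 0 2 i = at_levels p q (d' x))"
    and V: "i \<in> X <+> X" "j \<in> X <+> X"
  shows "(at_levels 0 2 i, at_levels 0 2 j) \<in> G\<^sup>* \<longleftrightarrow> (i, j) \<in> merged_edges c"
proof
  note M = equiv_merged_edges[OF c]
  have "(e (case_sum id id i), e (case_sum id id j)) \<in> merged_edges c"
    if "(i, j) \<in> fuse_edges X L" for i j
    using that M e by (auto simp: fuse_edges_def merged_edges_def equiv_def refl_on_def L_def)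
  \<comment> \<open>Edges of \<open>b\<close> are respected by \<open>bc\<close>; edges of the fused
    partition are respected because \<open>e\<close> maps \<open>L\<close> into the single merged
    class.\<close>
  then have step: "(\<phi> u, \<phi> v) \<in> merged_edges c" if "(u, v) \<in> G" for u v
    using that bc by (auto simp: in_level_graph \<phi> edges_fuse G_def)
  assume "(at_levels 0 2 i, at_levels 0 2 j) \<in> G\<^sup>*"
  then have "(\<phi> (at_levels 0 2 i), \<phi> (at_levels 0 2 j)) \<in> (merged_edges c)\<^sup>*"
    by (rule rtrancl_image[rotated]) (erule step)
  then have "(i, j) \<in> (merged_edges c)\<^sup>*"
    by (simp add: \<phi>)
  with M V show "(i, j) \<in> merged_edges c"
    by (metis equiv_rtrancl)
next
  assume ij: "(i, j) \<in> merged_edges c"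
  have sym: "sym (G\<^sup>*)"
    unfolding G_def by (intro sym_rtrancl sym_Un sym_level_graph)
  have eX: "e x \<in> X <+> X \<longleftrightarrow> x \<in> X" for x
    using e by auto
  have dX: "d x \<in> X <+> X \<longleftrightarrow> x \<in> X" "d' x \<in> X <+> X \<longleftrightarrow> x \<in> X" for x
    using d[of x] by (cases "d x"; cases "d' x"; auto)+
  \<comment> \<open>A point on the far side of the fused partition is joined to the glued level by
    its own line, from \<open>d' x\<close> to \<open>d x\<close>.\<close>
  have drop: "(at_levels k l t, at_levels 0 2 t) \<in> G\<^sup>*" if t: "t \<in> X <+> X" for t
    using outer[of t]
  proof
    assume "\<exists>x. t = e x \<and> at_levels 0 2 t = at_levels p q (d' x)"
    then obtain x where x: "t = e x" "at_levels 0 2 t = at_levels p q (d' x)" by auto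
    then have "(d x, d' x) \<in> edges (fuse X L)"
      using t eX dX d by (auto simp: edges_fuse fuse_edges_def)
    then show ?thesis
      using x glue by (auto simp: G_def dest: level_graphI[of _ _ _ p q])
  qed simp
  have inner: "(at_levels k l s, at_levels k l t) \<in> G\<^sup>*" if "(s, t) \<in> edges c" for s t
    using that cb unfolding G_def by (blast intro: level_graphI)
  have "(at_levels k l i, at_levels k l j) \<in> G\<^sup>*"
  proof (cases "(i, j) \<in> edges c")
    case True
    then show ?thesis by (rule inner)
  next
    case False
    then have U: "i \<in> transversal_part c" "j \<in> transversal_part c"
      using ij by (auto simp: merged_edges_def)
    \<comment> \<open>Each transversal block has a point on the glued side. These points lie over
      \<open>L\<close>, where the fused partition connects them.\<close>
    then obtain x y where xy: "(i, e x) \<in> edges c" "(j, e y) \<in> edges c"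
      using e by (fastforce simp: transversal_part_def)
    then have "x \<in> L" "y \<in> L"
      using U transversal_part_edges[OF c] by (auto simp: L_def)
    moreover have "x \<in> X" "y \<in> X"
      using xy equiv_type[OF equiv_edges[OF c]] eX by blast+
    ultimately have "(d x, d y) \<in> edges (fuse X L)"
      using dX d by (auto simp: edges_fuse fuse_edges_def)
    then have "(at_levels k l (e x), at_levels k l (e y)) \<in> G\<^sup>*"
      by (auto simp: G_def glue dest: level_graphI[of _ _ _ p q])
    then show ?thesis
      using inner[OF xy(1)] inner[OF xy(2)] sym by (meson rtrancl_trans symD)
  qed
  then show "(at_levels 0 2 i, at_levels 0 2 j) \<in> G\<^sup>*"
    using drop V sym by (meson rtrancl_trans symD)
qed

lemma partition_on_merge_transversals:
  "partition_on (X <+> X) c \<Longrightarrow> partition_on (X <+> X) (merge_transversals X c)"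
  unfolding merge_transversals_def by (intro partition_on_quotient equiv_merged_edges)

text \<open>Allowing any \<open>b\<close> between c and T c lets one right factor serve for both
  products in the Mitsch order.\<close>

lemma mult_fuse_right:
  assumes c: "partition_on (X <+> X) c"
    and bc: "edges c \<subseteq> edges b" "edges b \<subseteq> merged_edges c"
  shows "partition_mult X b (fuse X {y. Inr y \<in> transversal_part c}) = merge_transversals X c"
proof (rule partition_eqI[OF partition_on_mult partition_on_merge_transversals[OF c]])
  \<comment> \<open>Levels 1 and 2 collapse to the second copy, where \<open>b\<close> is glued to
    the fused partition.\<close>
  define \<phi> :: "nat \<times> 'a \<Rightarrow> 'a + 'a" where "\<phi> = (\<lambda>(n, x). if n = 0 then Inl x else Inr x)"
  have "(at_levels 0 2 i, at_levels 0 2 j) \<in> (level_graph 0 1 b \<union>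
      level_graph 1 2 (fuse X {y. Inr y \<in> transversal_part c}))\<^sup>* \<longleftrightarrow> (i, j) \<in> merged_edges c"
    if "i \<in> X <+> X" "j \<in> X <+> X" for i j
    by (rule fuse_connectivity[OF c bc, where \<phi> = \<phi> and d = Inl and d' = Inr])
      (use that in \<open>auto simp: \<phi>_def at_levels_def split: sum.splits\<close>)
  then show "edges (partition_mult X b (fuse X {y. Inr y \<in> transversal_part c})) =
      edges (merge_transversals X c)"
    using equiv_type[OF equiv_merged_edges[OF c]]
    by (auto simp: edges_mult edges_merge_transversals[OF c] mult_edges_def product_graph_eq)
qed

lemma mult_fuse_left:
  assumes c: "partition_on (X <+> X) c"
    and bc: "edges c \<subseteq> edges b" "edges b \<subseteq> merged_edges c"
  shows "partition_mult X (fuse X {y. Inl y \<in> transversal_part c}) b = merge_transversals X c"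
proof (rule partition_eqI[OF partition_on_mult partition_on_merge_transversals[OF c]])
  \<comment> \<open>In the mirror image, levels 0 and 1 collapse to the first copy.\<close>
  define \<phi> :: "nat \<times> 'a \<Rightarrow> 'a + 'a" where "\<phi> = (\<lambda>(n, x). if n = 2 then Inr x else Inl x)"
  have "(at_levels 0 2 i, at_levels 0 2 j) \<in> (level_graph 1 2 b \<union>
      level_graph 0 1 (fuse X {y. Inl y \<in> transversal_part c}))\<^sup>* \<longleftrightarrow> (i, j) \<in> merged_edges c"
    if "i \<in> X <+> X" "j \<in> X <+> X" for i j
    by (rule fuse_connectivity[OF c bc, where \<phi> = \<phi> and d = Inr and d' = Inl])
      (use that in \<open>auto simp: \<phi>_def at_levels_def split: sum.splits\<close>)
  then show "edges (partition_mult X (fuse X {y. Inl y \<in> transversal_part c}) b) =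
      edges (merge_transversals X c)"
    using equiv_type[OF equiv_merged_edges[OF c]]
    by (auto simp: edges_mult edges_merge_transversals[OF c] mult_edges_def product_graph_eq Un_ac)
qed

text \<open>Multiplying c by the fused identity joins its transversal blocks; once they are joined,
  multiplying again changes nothing.\<close>

lemma merge_transversals_mitsch:
  assumes c: "partition_on (X <+> X) c"
  shows "(merge_transversals X c, c) \<in> mitsch_order (partition_monoid X)"
proof -
  let ?d = "merge_transversals X c"
  let ?x = "fuse X {y. Inr y \<in> transversal_part c}"
  let ?y = "fuse X {y. Inl y \<in> transversal_part c}"
  have "edges c \<subseteq> merged_edges c" by (simp add: merged_edges_def)
  then have "partition_mult X ?d ?x = ?d" "partition_mult X c ?x = ?d" "partition_mult X ?y c = ?d"
    using c by (simp_all add: mult_fuse_right mult_fuse_left edges_merge_transversals)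
  then have "\<exists>x\<in>Collect (partition_on (X <+> X)). \<exists>y\<in>Collect (partition_on (X <+> X)).
      ?d = partition_mult X ?d x \<and> ?d = partition_mult X c x \<and> ?d = partition_mult X y c"
    by (metis mem_Collect_eq partition_on_fuse)
  then show ?thesis
    using c partition_on_merge_transversals[OF c] by (simp add: mitsch_order_def)
qed

section \<open>The composite relation and the join\<close>

text \<open>T c always serves as the middle element: it lies below c in the Mitsch order and
  contains every element that does.\<close>

lemma inclusion_mitsch_iff:
  "(a, c) \<in> inclusion_order X O mitsch_order (partition_monoid X) \<longleftrightarrow>
    partition_on (X <+> X) a \<and> partition_on (X <+> X) c \<and> edges a \<subseteq> merged_edges c"
proof
  assume "(a, c) \<in> inclusion_order X O mitsch_order (partition_monoid X)"
  then show "partition_on (X <+> X) a \<and> partition_on (X <+> X) c \<and> edges a \<subseteq> merged_edges c"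
    using mitsch_order_merged_edges[of _ c X]
    by (auto simp: inclusion_order_def mitsch_order_def)
next
  assume "partition_on (X <+> X) a \<and> partition_on (X <+> X) c \<and> edges a \<subseteq> merged_edges c"
  then have "(a, merge_transversals X c) \<in> inclusion_order X"
    "(merge_transversals X c, c) \<in> mitsch_order (partition_monoid X)"
    by (auto simp: inclusion_order_def edges_merge_transversals
        partition_on_merge_transversals merge_transversals_mitsch)
  then show "(a, c) \<in> inclusion_order X O mitsch_order (partition_monoid X)" by auto
qed

lemma preorder_inclusion_mitsch:
  "preorder_on (carrier (partition_monoid X)) (inclusion_order X O mitsch_order (partition_monoid X))"
proof -
  have "trans (inclusion_order X O mitsch_order (partition_monoid X))"
  proof (rule transI)
    fix a b c
    assume "(a, b) \<in> inclusion_order X O mitsch_order (partition_monoid X)"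
      and "(b, c) \<in> inclusion_order X O mitsch_order (partition_monoid X)"
    then show "(a, c) \<in> inclusion_order X O mitsch_order (partition_monoid X)"
      \<comment> \<open>From b inside T c follows T b inside T c, and a lies inside T b.\<close>
      unfolding inclusion_mitsch_iff using merged_edges_mono[of _ c b] by blast
  qed
  moreover have "refl_on (carrier (partition_monoid X))
      (inclusion_order X O mitsch_order (partition_monoid X))"
    by (auto simp: refl_on_def inclusion_mitsch_iff merged_edges_def)
  ultimately show ?thesis
    by (auto simp: preorder_on_def inclusion_order_def mitsch_order_def)
qed

theorem corollary6p7:
  fixes X :: "'a set"
  shows "preorder_on (carrier (partition_monoid X))
           (inclusion_order X O mitsch_order (partition_monoid X)) \<and>
         mitsch_order (partition_monoid X) O inclusion_order X
           \<subseteq> inclusion_order X O mitsch_order (partition_monoid X) \<and>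
         is_preorder_join (carrier (partition_monoid X))
           (inclusion_order X) (mitsch_order (partition_monoid X))
           (inclusion_order X O mitsch_order (partition_monoid X))"
proof -
  let ?M = "mitsch_order (partition_monoid X)"
  let ?t = "inclusion_order X O ?M"
  note t = preorder_inclusion_mitsch[of X]
  have "inclusion_order X \<subseteq> ?t"
    by (auto simp: inclusion_mitsch_iff)
      (auto simp: inclusion_order_def merged_edges_def)
  moreover have "?M \<subseteq> ?t"
    using mitsch_order_merged_edges[of _ _ X]
    by (auto simp: inclusion_mitsch_iff) (auto simp: mitsch_order_def)
  \<comment> \<open>Both factors lie in the preorder \<open>?t\<close>, whose transitivity absorbs
    their composite in either order.\<close>
  moreover from calculation t have "?M O inclusion_order X \<subseteq> ?t"
    by (auto simp: preorder_on_def dest: transD)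
  moreover have "?t \<subseteq> u"
    if "preorder_on (carrier (partition_monoid X)) u" "inclusion_order X \<subseteq> u" "?M \<subseteq> u" for u
    using that by (auto simp: preorder_on_def dest: transD)
  ultimately show ?thesis
    using t preorder_inclusion_order preorder_mitsch_partition_monoid
    unfolding is_preorder_join_def by blast
qed

end
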